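(* Let $\mathcal{H}$ be a real Hilbert space, and let $K_{1}$ and $K_{2}$ be nonempty closed convex cones in $\mathcal{H}$. Suppose that $c_{0}(K_{1},K_{2})<1$ and that $X$ is a convex subset of $\mathcal{H}$ which contains $K_{1}-K_{2}$. Then $$c_{0}(K_{1},K_{2})\;\leq\; c_{0}\big(K_{1}^{\oplus}\cap X,\;K_{2}^{\ominus}\cap X\big)\;\leq\; c_{0}\big(K_{1}^{\oplus},\;K_{2}^{\ominus}\big).$$
   Context: $\mathcal{H}$ has inner product $\langle\cdot,\cdot\rangle$ and induced norm $\|\cdot\|$; $\mathbf{B}_{\mathcal{H}}$ denotes the closed unit ball. For $S\subseteq\mathcal{H}$, $\overline{\operatorname{cone}}(S)$ is the smallest closed convex cone containing $S$ (so $\overline{\operatorname{cone}}(K)=K$ if $K$ is a nonempty closed convex cone; nonempty closed cones contain $0$). For nonempty convex sets $C,D\subseteq\mathcal{H}$, the cosine of the Dixmier (minimal) angle is $$c_{0}(C,D):=\sup\{\langle x,y\rangle \mid x\in\overline{\operatorname{cone}}(C)\cap\mathbf{B}_{\mathcal{H}},\ y\in\overline{\operatorname{cone}}(D)\cap\mathbf{B}_{\mathcal{H}}\}.$$ For nonempty $C\subseteq\mathcal{H}$, the polar cone is $C^{\ominus}:=\{y\in\mathcal{H}\mid \langle x,y\rangle\leq 0\ \text{for all } x\in C\}$ and the dual cone is $C^{\oplus}:=-C^{\ominus}$. Also $K_{1}-K_{2}=\{x-y\mid x\in K_{1},\,y\in K_{2}\}$. *)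

theory Defs
  imports "HOL-Analysis.Analysis"
begin

text \<open>
  The library predicate \<^const>\<open>cone\<close> asks for closure under scaling by all \<open>c \<ge> 0\<close>. For nonempty
  closed sets this agrees with closure under scaling by all \<open>c > 0\<close>.
\<close>

definition closed_convex_cone_hull :: "'a::real_normed_vector set \<Rightarrow> 'a set" where
  "closed_convex_cone_hull S = (\<lambda>K. closed K \<and> convex K \<and> cone K) hull S"

text \<open>
  For nonempty \<open>C\<close> and \<open>D\<close> the set below contains \<open>0\<close> and is bounded above by \<open>1\<close>, so the real
  supremum is the genuine one. The value is of no significance if \<open>C\<close> or \<open>D\<close> is empty.
\<close>

definition dixmier_cos :: "'a::real_inner set \<Rightarrow> 'a set \<Rightarrow> real" where
  "dixmier_cos C D =
     Sup {x \<bullet> y | x y. x \<in> closed_convex_cone_hull C \<inter> cball 0 1 \<and>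
                      y \<in> closed_convex_cone_hull D \<inter> cball 0 1}"

definition polar_cone :: "'a::real_inner set \<Rightarrow> 'a set" where
  "polar_cone C = {y. \<forall>x\<in>C. x \<bullet> y \<le> 0}"

definition dual_cone :: "'a::real_inner set \<Rightarrow> 'a set" where
  "dual_cone C = uminus ` polar_cone C"

end

theory Submission
  imports Defs
begin

text \<open>
  The second inequality is monotonicity of \<^const>\<open>dixmier_cos\<close>. For the first, write \<open>c\<close> for the
  cosine of \<open>K1\<close> and \<open>K2\<close> and \<open>d\<close> for the cosine of the two intersections with \<open>X\<close>.
  These intersections contain \<open>0\<close>, so \<open>d \<ge> 0\<close> and only the case \<open>c > 0\<close> has content.

  Suppose first that the supremum defining \<open>c > 0\<close> is attained at \<open>x \<in> K1\<close>, \<open>y \<in> K2\<close>. Then \<open>x\<close> and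
  \<open>y\<close> are unit vectors, the projection of \<open>x\<close> onto \<open>K2\<close> is \<open>c y\<close> and that of \<open>y\<close> onto \<open>K1\<close> is \<open>c x\<close>.
  The residuals \<open>u = c x - y\<close> and \<open>v = x - c y\<close> lie in \<open>K1 - K2 \<subseteq> X\<close>, and by Moreau's
  characterisation of projections onto cones, \<open>u\<close> is in the dual cone of \<open>K1\<close> and \<open>v\<close> in the polar
  cone of \<open>K2\<close>. Both have squared norm \<open>1 - c\<^sup>2\<close>, while \<open>u \<bullet> v = c - c ^ 3\<close>. So \<open>u\<close> and \<open>v\<close> again
  form an angle of cosine \<open>c\<close>, and \<open>c \<le> d\<close>.

  In infinite dimension the supremum need not be attained. The same residuals, taken for arbitrary
  \<open>x\<close> and \<open>y\<close> in the unit ball with \<open>s = x \<bullet> y > 0\<close>, still satisfy \<open>u \<bullet> v \<ge> s - c ^ 3\<close> and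
  \<open>norm u * norm v \<le> 1 - s\<^sup>2\<close>, whence \<open>s - c ^ 3 \<le> d * (1 - s\<^sup>2)\<close>. This is a closed condition on
  \<open>s\<close>, so it passes to the supremum \<open>c\<close>; dividing \<open>c - c ^ 3 \<le> d * (1 - c\<^sup>2)\<close> by \<open>1 - c\<^sup>2 > 0\<close> gives
  \<open>c \<le> d\<close>. It is in this division that \<open>c < 1\<close> enters.
\<close>

section \<open>Projection onto closed convex sets and cones in a Hilbert space\<close>

text \<open>
  By the parallelogram law, points of \<open>K\<close> that nearly minimise the distance to \<open>x\<close> are close to each
  other, since their midpoint is in \<open>K\<close> as well. So the sets of near-minimisers shrink to a point by
  completeness.
\<close>

lemma closest_point_exists_complete:
  fixes x :: "'a::{real_inner, complete_space}"
  assumes "closed K" "convex K" "K \<noteq> {}"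
  obtains p where "p \<in> K" "\<And>z. z \<in> K \<Longrightarrow> dist x p \<le> dist x z"
proof -
  define m where "m = Inf ((\<lambda>z. (norm (x - z))\<^sup>2) ` K)"
  have bdd: "bdd_below ((\<lambda>z. (norm (x - z))\<^sup>2) ` K)"
    by (intro bdd_belowI[of _ 0]) auto
  have m_le: "m \<le> (norm (x - z))\<^sup>2" if "z \<in> K" for z
    unfolding m_def using that by (intro cInf_lower bdd) auto
  define S where "S n = K \<inter> {z. (norm (x - z))\<^sup>2 \<le> m + 1 / real (Suc n)}" for n
  obtain p where p: "\<And>n. p \<in> S n"
  proof (rule decreasing_closed_nest[of S])
    show "closed (S n)" for n
      unfolding S_def
      by (intro closed_Int assms(1) closed_Collect_le continuous_intros)
    show "S n \<noteq> {}" for n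
    proof -
      have "\<exists>r\<in>(\<lambda>z. (norm (x - z))\<^sup>2) ` K. r < m + 1 / real (Suc n)"
        unfolding m_def
        by (rule cInf_lessD) (use assms(3) in auto)
      then show ?thesis
        unfolding S_def using less_imp_le by blast
    qed
    show "S n \<subseteq> S k" if "k \<le> n" for k n
    proof -
      have "1 / real (Suc n) \<le> 1 / real (Suc k)"
        using that by (simp add: field_simps)
      then show ?thesis
        unfolding S_def by fastforce
    qed
    show "\<exists>n. \<forall>a\<in>S n. \<forall>b\<in>S n. dist a b < \<epsilon>" if "\<epsilon> > 0" for \<epsilon>
    proof -
      obtain n where n: "1 / real (Suc n) < \<epsilon>\<^sup>2 / 4"
        using reals_Archimedean[of "\<epsilon>\<^sup>2 / 4"] \<open>\<epsilon> > 0\<close> by (auto simp: inverse_eq_divide)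
      have "dist a b < \<epsilon>" if "a \<in> S n" "b \<in> S n" for a b
      proof -
        have "(1/2) *\<^sub>R a + (1/2) *\<^sub>R b \<in> K"
          using that assms(2) by (intro convexD) (auto simp: S_def)
        then have mid: "m \<le> (norm (x - ((1/2) *\<^sub>R a + (1/2) *\<^sub>R b)))\<^sup>2"
          by (rule m_le)
        have "(norm (a - b))\<^sup>2 = 2 * (norm (x - a))\<^sup>2 + 2 * (norm (x - b))\<^sup>2
            - 4 * (norm (x - ((1/2) *\<^sub>R a + (1/2) *\<^sub>R b)))\<^sup>2"
          by (simp add: power2_norm_eq_inner inner_diff_left inner_diff_right inner_add_left
              inner_add_right inner_commute algebra_simps)
        also have "\<dots> \<le> 4 * (1 / real (Suc n))"
          using that mid by (auto simp: S_def)
        also have "\<dots> < \<epsilon>\<^sup>2"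
          using n by simp
        finally show ?thesis
          using \<open>\<epsilon> > 0\<close> by (simp add: dist_norm power2_less_imp_less)
      qed
      then show ?thesis by blast
    qed
  qed blast
  show ?thesis
  proof
    show "p \<in> K"
      using p[of 0] by (simp add: S_def)
    have "(norm (x - p))\<^sup>2 \<le> m"
    proof (rule field_le_epsilon)
      fix e :: real assume "e > 0"
      then obtain n where "1 / real (Suc n) < e"
        using reals_Archimedean by (auto simp: inverse_eq_divide)
      then show "(norm (x - p))\<^sup>2 \<le> m + e"
        using p[of n] by (auto simp: S_def)
    qed
    then show "dist x p \<le> dist x z" if "z \<in> K" for z
      unfolding dist_norm using power2_le_imp_le[OF order_trans[OF _ m_le[OF that]] norm_ge_zero] by blast
  qed
qed

text \<open>
  Moreau's characterisation: the variational inequality for the closest point \<open>p\<close>, tested against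
  \<open>0\<close> and \<open>2 p\<close>, forces orthogonality of \<open>p\<close> and the residual; tested against \<open>p + k\<close>, it puts the
  residual into the polar cone.
\<close>

lemma cone_projection_exists:
  fixes x :: "'a::{real_inner, complete_space}"
  assumes "closed K" "convex K" "cone K" "K \<noteq> {}"
  obtains p where "p \<in> K" "(x - p) \<bullet> p = 0" "x - p \<in> polar_cone K"
proof -
  obtain p where p: "p \<in> K" "\<And>z. z \<in> K \<Longrightarrow> dist x p \<le> dist x z"
    using closest_point_exists_complete[OF assms(1,2,4)] by blast
  have var: "(x - p) \<bullet> (z - p) \<le> 0" if "z \<in> K" for z
    using any_closest_point_dot[OF assms(2,1) p(1) that] p(2) by blast
  have add: "a + b \<in> K" if "a \<in> K" "b \<in> K" for a b
    using that assms(2,3) convex_cone[of K] by blast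
  have "(x - p) \<bullet> p \<le> 0"
    using var[OF add[OF p(1) p(1)]] by simp
  moreover have "(x - p) \<bullet> p \<ge> 0"
    using var[of 0] assms(3,4) cone_contains_0 by fastforce
  moreover have "x - p \<in> polar_cone K"
    unfolding polar_cone_def
    using var[OF add[OF p(1)]] by (auto simp: inner_commute)
  ultimately show thesis
    using that p(1) by simp
qed

section \<open>The Dixmier cosine\<close>

lemma closed_convex_cone_hull_is_cone: "cone (closed_convex_cone_hull S)"
  unfolding closed_convex_cone_hull_def hull_def cone_def by blast

lemma closed_convex_cone_hull_inc: "x \<in> S \<Longrightarrow> x \<in> closed_convex_cone_hull S"
  unfolding closed_convex_cone_hull_def by (rule hull_inc)

lemma closed_convex_cone_hull_eq:
  "closed K \<Longrightarrow> convex K \<Longrightarrow> cone K \<Longrightarrow> closed_convex_cone_hull K = K"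
  unfolding closed_convex_cone_hull_def by (rule hull_same) blast

lemma dixmier_cos_bdd_above:
  fixes C D :: "'a::real_inner set"
  shows "bdd_above {x \<bullet> y | x y. x \<in> closed_convex_cone_hull C \<inter> cball 0 1 \<and>
                                y \<in> closed_convex_cone_hull D \<inter> cball 0 1}"
proof (rule bdd_aboveI[of _ 1])
  fix r
  assume "r \<in> {x \<bullet> y | x y. x \<in> closed_convex_cone_hull C \<inter> cball 0 1 \<and>
                           y \<in> closed_convex_cone_hull D \<inter> cball 0 1}"
  then obtain x y :: 'a where "r = x \<bullet> y" "norm x \<le> 1" "norm y \<le> 1"
    by auto
  then show "r \<le> 1"
    using norm_cauchy_schwarz[of x y] mult_mono[of "norm x" 1 "norm y" 1] by simp
qed

lemma inner_le_dixmier_cos: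
  assumes "x \<in> C" "y \<in> D"
  shows "x \<bullet> y \<le> dixmier_cos C D * norm x * norm y"
proof (cases "x = 0 \<or> y = 0")
  case False
  have unit: "(1 / norm z) *\<^sub>R z \<in> closed_convex_cone_hull S \<inter> cball 0 1"
    if "z \<in> S" for z :: 'a and S
    using closed_convex_cone_hull_is_cone[of S] closed_convex_cone_hull_inc[OF that]
    by (auto simp: cone_def)
  have "((1 / norm x) *\<^sub>R x) \<bullet> ((1 / norm y) *\<^sub>R y) \<le> dixmier_cos C D"
    unfolding dixmier_cos_def
    using unit[OF assms(1)] unit[OF assms(2)]
    by (intro cSup_upper dixmier_cos_bdd_above) blast
  then show ?thesis
    using False by (simp add: field_simps)
qed auto

lemma dixmier_cos_mono:
  assumes "C \<subseteq> C'" "D \<subseteq> D'" "C \<noteq> {}" "D \<noteq> {}"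
  shows "dixmier_cos C D \<le> dixmier_cos C' D'"
proof -
  have sub: "closed_convex_cone_hull S \<subseteq> closed_convex_cone_hull T" if "S \<subseteq> T" for S T :: "'a set"
    unfolding closed_convex_cone_hull_def using that by (rule hull_mono)
  have zero: "0 \<in> closed_convex_cone_hull S \<inter> cball 0 1" if "S \<noteq> {}" for S :: "'a set"
    using that closed_convex_cone_hull_is_cone[of S] closed_convex_cone_hull_inc[of _ S]
    by (metis IntI cone_contains_0 centre_in_cball empty_iff equals0I zero_le_one)
  show ?thesis
    unfolding dixmier_cos_def
    by (rule cSup_subset_mono[OF _ dixmier_cos_bdd_above])
      (use zero[OF assms(3)] zero[OF assms(4)] sub[OF assms(1)] sub[OF assms(2)] in blast)+
qed

lemma dixmier_cos_nonneg:
  assumes "0 \<in> C" "0 \<in> D"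
  shows "0 \<le> dixmier_cos C D"
proof -
  have "0 \<bullet> 0 \<le> dixmier_cos C D"
    unfolding dixmier_cos_def
    using assms[THEN closed_convex_cone_hull_inc]
    by (intro cSup_upper dixmier_cos_bdd_above) force
  then show ?thesis by simp
qed

section \<open>Comparing the angle of two cones with the angle of residuals\<close>

text \<open>
  The sets \<open>C\<close> and \<open>D\<close> stand for any pair containing, up to sign, the residuals of the projections
  between \<open>K1\<close> and \<open>K2\<close>. Put \<open>s = x \<bullet> y\<close>, let \<open>c\<close> be the cosine of \<open>K1\<close> and \<open>K2\<close>, and let \<open>p\<close> be the
  projection of \<open>x\<close> onto \<open>K2\<close>. Then \<open>s \<le> norm p \<le> c\<close>: the lower bound because \<open>x - p\<close> has a
  nonpositive inner product with \<open>y\<close>, so that \<open>s \<le> y \<bullet> p\<close>; the upper bound because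
  \<open>(norm p)\<^sup>2 = x \<bullet> p \<le> c * norm p\<close>. The lower bound gives
  \<open>(norm (x - p))\<^sup>2 = (norm x)\<^sup>2 - (norm p)\<^sup>2 \<le> 1 - s\<^sup>2\<close>. With \<open>q\<close> the projection of \<open>y\<close> onto \<open>K1\<close>,
  the upper bounds give \<open>q \<bullet> p \<le> c * norm q * norm p \<le> c ^ 3\<close>. Together with \<open>q \<bullet> x \<ge> s\<close> and
  \<open>y \<bullet> p \<ge> s\<close> this yields \<open>(q - y) \<bullet> (x - p) \<ge> s - c ^ 3\<close> upon expansion.
\<close>

lemma inner_residual_bound:
  fixes K1 K2 :: "'a::{real_inner, complete_space} set"
  assumes K1: "K1 \<noteq> {}" "closed K1" "convex K1" "cone K1"
    and K2: "K2 \<noteq> {}" "closed K2" "convex K2" "cone K2"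
    and C: "\<And>a b. a \<in> K1 \<Longrightarrow> b \<in> K2 \<Longrightarrow> a - b \<in> dual_cone K1 \<Longrightarrow> a - b \<in> C"
    and D: "\<And>a b. a \<in> K1 \<Longrightarrow> b \<in> K2 \<Longrightarrow> a - b \<in> polar_cone K2 \<Longrightarrow> a - b \<in> D"
    and d: "0 \<le> dixmier_cos C D"
    and x: "x \<in> K1" "norm x \<le> 1" and y: "y \<in> K2" "norm y \<le> 1" and pos: "0 < x \<bullet> y"
  shows "x \<bullet> y - dixmier_cos K1 K2 ^ 3 \<le> dixmier_cos C D * (1 - (x \<bullet> y)\<^sup>2)"
proof -
  define c s where "c = dixmier_cos K1 K2" and "s = x \<bullet> y"
  have c_bound: "a \<bullet> b \<le> c * norm a * norm b" if "a \<in> K1" "b \<in> K2" for a b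
    unfolding c_def using that by (rule inner_le_dixmier_cos)
  have "0 < c * norm x * norm y"
    using c_bound[OF x(1) y(1)] pos by simp
  then have c: "0 < c"
    by (simp add: zero_less_mult_iff)
  obtain p where p: "p \<in> K2" "(x - p) \<bullet> p = 0" "x - p \<in> polar_cone K2"
    using cone_projection_exists[OF K2(2,3,4,1)] by blast
  obtain q where q: "q \<in> K1" "(y - q) \<bullet> q = 0" "y - q \<in> polar_cone K1"
    using cone_projection_exists[OF K1(2,3,4,1)] by blast
  have v: "x - p \<in> D"
    using D[OF x(1) p(1) p(3)] .
  have "q - y \<in> dual_cone K1"
    unfolding dual_cone_def using q(3) by (metis image_eqI minus_diff_eq)
  then have u: "q - y \<in> C"
    by (rule C[OF q(1) y(1)])
  have sp: "s \<le> y \<bullet> p"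
    using p(3) y(1) by (auto simp: polar_cone_def s_def inner_diff_right inner_commute)
  have sq: "s \<le> x \<bullet> q"
    using q(3) x(1) by (auto simp: polar_cone_def s_def inner_diff_right)

  \<comment> \<open>The estimate below serves both projections, with the roles of the cones exchanged.\<close>
  have residual: "norm r \<le> c \<and> (norm (w - r))\<^sup>2 \<le> 1 - s\<^sup>2"
    if orth: "(w - r) \<bullet> r = 0" and w: "norm w \<le> 1" and z: "norm z \<le> 1" and sz: "s \<le> z \<bullet> r"
      and wr: "w \<bullet> r \<le> c * norm w * norm r" for w r z :: 'a
  proof -
    have rr: "w \<bullet> r = (norm r)\<^sup>2"
      using orth by (simp add: inner_diff_left power2_norm_eq_inner)
    have "z \<bullet> r \<le> norm z * norm r"
      by (rule norm_cauchy_schwarz)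
    also have "\<dots> \<le> norm r"
      using z by (simp add: mult_left_le_one_le)
    finally have sr: "s \<le> norm r"
      using sz by simp
    then have r: "0 < norm r"
      using pos unfolding s_def by (rule less_le_trans[rotated])
    have "c * norm w * norm r \<le> c * norm r"
      using w c by (simp add: mult_left_le_one_le)
    then have "norm r * norm r \<le> c * norm r"
      using wr rr by (simp add: power2_eq_square)
    then have "norm r \<le> c"
      using r by simp
    moreover have "(norm (w - r))\<^sup>2 = (norm w)\<^sup>2 - (norm r)\<^sup>2"
      using rr by (simp add: power2_norm_eq_inner inner_diff_left inner_diff_right inner_commute)
    moreover have "(norm w)\<^sup>2 \<le> 1"
      using w by (simp add: power_le_one)
    moreover have "s\<^sup>2 \<le> (norm r)\<^sup>2"
      using sr pos by (intro power_mono) (auto simp: s_def)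
    ultimately show ?thesis by simp
  qed
  have P: "norm p \<le> c" "(norm (x - p))\<^sup>2 \<le> 1 - s\<^sup>2"
    using residual[OF p(2) x(2) y(2) sp c_bound[OF x(1) p(1)]] by auto
  have Q: "norm q \<le> c" "(norm (y - q))\<^sup>2 \<le> 1 - s\<^sup>2"
    using residual[OF q(2) y(2) x(2) sq] c_bound[OF q(1) y(1)]
    by (auto simp: inner_commute mult_ac)

  have "q \<bullet> p \<le> c * (norm q * norm p)"
    using c_bound[OF q(1) p(1)] by (simp add: mult_ac)
  also have "\<dots> \<le> c * (c * c)"
    using P(1) Q(1) c by (intro mult_left_mono mult_mono) auto
  finally have "q \<bullet> p \<le> c ^ 3"
    by (simp add: power3_eq_cube)
  then have "s - c ^ 3 \<le> (q - y) \<bullet> (x - p)"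
    using sp sq by (simp add: inner_diff_left inner_diff_right inner_commute s_def)
  also have "\<dots> \<le> dixmier_cos C D * (norm (q - y) * norm (x - p))"
    using inner_le_dixmier_cos[OF u v] by (simp add: mult_ac)
  also have "\<dots> \<le> dixmier_cos C D * (1 - s\<^sup>2)"
  proof (rule mult_left_mono[OF _ d])
    have "2 * (norm (q - y) * norm (x - p)) \<le> (norm (q - y))\<^sup>2 + (norm (x - p))\<^sup>2"
      using sum_squares_bound[of "norm (q - y)" "norm (x - p)"] by simp
    also have "\<dots> \<le> 2 * (1 - s\<^sup>2)"
      using P(2) Q(2) by (simp add: norm_minus_commute)
    finally show "norm (q - y) * norm (x - p) \<le> 1 - s\<^sup>2"
      by simp
  qed
  finally show ?thesis
    by (simp add: c_def s_def)
qed

theorem theorem3p1: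
  fixes K1 K2 X :: "'a::{real_inner, complete_space} set"
  assumes "K1 \<noteq> {}" and "closed K1" and "convex K1" and "cone K1"
    and "K2 \<noteq> {}" and "closed K2" and "convex K2" and "cone K2"
    and "dixmier_cos K1 K2 < 1"
    and "convex X" and "{x - y | x y. x \<in> K1 \<and> y \<in> K2} \<subseteq> X"
  shows "dixmier_cos K1 K2 \<le> dixmier_cos (dual_cone K1 \<inter> X) (polar_cone K2 \<inter> X) \<and>
         dixmier_cos (dual_cone K1 \<inter> X) (polar_cone K2 \<inter> X)
           \<le> dixmier_cos (dual_cone K1) (polar_cone K2)"
proof
  let ?C = "dual_cone K1 \<inter> X" and ?D = "polar_cone K2 \<inter> X"
  have zeroK: "0 \<in> K1" "0 \<in> K2"
    using assms(1,4,5,8) by (simp_all add: cone_contains_0)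
  have "0 - 0 \<in> X"
    using zeroK assms(11) by blast
  then have zero: "0 \<in> ?C" "0 \<in> ?D"
    by (auto simp: dual_cone_def polar_cone_def image_iff)
  then have d: "0 \<le> dixmier_cos ?C ?D"
    by (rule dixmier_cos_nonneg)
  define c where "c = dixmier_cos K1 K2"
  define A where "A = {x \<bullet> y | x y. x \<in> K1 \<inter> cball 0 1 \<and> y \<in> K2 \<inter> cball 0 1}"
  have hulls: "closed_convex_cone_hull K1 = K1" "closed_convex_cone_hull K2 = K2"
    using assms(2-4,6-8) by (simp_all add: closed_convex_cone_hull_eq)
  have bdd: "bdd_above A"
    using dixmier_cos_bdd_above[of K1 K2] by (simp add: A_def hulls)
  have c_Sup: "c = Sup A"
    by (simp add: c_def dixmier_cos_def A_def hulls)
  have "\<exists>x y. (0::real) = x \<bullet> y \<and> x \<in> K1 \<inter> cball 0 1 \<and> y \<in> K2 \<inter> cball 0 1"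
    by (intro exI[of _ 0]) (use zeroK in simp)
  then have "A \<noteq> {}"
    unfolding A_def by blast
  \<comment> \<open>Nonpositive values are admitted into the closed set so that it contains all of \<open>A\<close>.\<close>
  define T where "T = {s. s \<le> 0 \<or> s - c ^ 3 \<le> dixmier_cos ?C ?D * (1 - s\<^sup>2)}"
  have "closed T"
    unfolding T_def by (intro closed_Collect_disj closed_Collect_le continuous_intros)
  moreover have "A \<subseteq> T"
  proof
    fix s assume "s \<in> A"
    then obtain x y where "s = x \<bullet> y" "x \<in> K1" "norm x \<le> 1" "y \<in> K2" "norm y \<le> 1"
      by (auto simp: A_def)
    moreover have "a - b \<in> X" if "a \<in> K1" "b \<in> K2" for a b
      using that assms(11) by blast
    ultimately show "s \<in> T"
      using inner_residual_bound[OF assms(1-8) _ _ d, of x y]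
      by (force simp: T_def c_def)
  qed
  ultimately have "c \<in> T"
    unfolding c_Sup using \<open>A \<noteq> {}\<close> bdd by (intro closed_subset_contains_Sup)
  then show "c \<le> dixmier_cos ?C ?D"
    unfolding T_def
  proof (elim CollectE disjE)
    assume bound: "c - c ^ 3 \<le> dixmier_cos ?C ?D * (1 - c\<^sup>2)"
    have "c \<ge> 0"
      unfolding c_def using zeroK by (rule dixmier_cos_nonneg)
    then have "c\<^sup>2 < 1"
      using assms(9) by (simp add: c_def power_less_one_iff)
    moreover have "c - c ^ 3 = c * (1 - c\<^sup>2)"
      by (simp add: algebra_simps power2_eq_square power3_eq_cube)
    ultimately show ?thesis
      using bound by simp
  qed (use d in simp)
  show "dixmier_cos ?C ?D \<le> dixmier_cos (dual_cone K1) (polar_cone K2)"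
    using zero by (intro dixmier_cos_mono) auto
qed

end
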